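(* For every integer $k\ge 2$, $$HJ^*(k;2) > \frac{2^{\frac{k-1}{3}}-1}{(k-1)^{\frac23}}.$$
   Context: Identify $[k]$ with the alphabet $\{0,1,\dots,k-1\}$. A cg-word of length $n$ is a word $v(x)$ of length $n$ over the alphabet $\{0,1,\dots,k-1,x,k-1-x\}$ (where $x$ and $k-1-x$ are formal symbols) in which the symbol $x$ occurs at least once (the symbol $k-1-x$ need not occur). For $a\in\{0,\dots,k-1\}$, $v(a)\in\{0,\dots,k-1\}^n$ is obtained by replacing each symbol $x$ by $a$ and each symbol $k-1-x$ by the number $k-1-a$. The cg-line determined by $v$ is the sequence $v(0),v(1),\dots,v(k-1)$. The CG-Hales-Jewett number $HJ^*(k;r)$ is the least positive integer $n$ such that every $r$-coloring of $[k]^n$ contains a monochromatic cg-line (of full length $k$). *)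

theory Defs
  imports Complex_Main "HOL-Library.FuncSet"
begin

text \<open>
  Points of \<open>[k]\<^sup>n\<close> are lists of length \<open>n\<close> over \<open>{..<k}\<close>.
\<close>

definition cube :: "nat \<Rightarrow> nat \<Rightarrow> nat list set" where
  "cube k n = {p. length p = n \<and> set p \<subseteq> {..<k}}"

text \<open>\<open>X\<close> is the formal symbol \<open>x\<close> and \<open>CoX\<close> the formal symbol \<open>k - 1 - x\<close>.\<close>

datatype cg_symbol = Letter nat | X | CoX

definition cg_words :: "nat \<Rightarrow> nat \<Rightarrow> cg_symbol list set" where
  "cg_words k n =
     {v. length v = n \<and> set v \<subseteq> Letter ` {..<k} \<union> {X, CoX} \<and> X \<in> set v}"

fun subst_symbol :: "nat \<Rightarrow> nat \<Rightarrow> cg_symbol \<Rightarrow> nat" where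
  "subst_symbol k a (Letter b) = b"
| "subst_symbol k a X = a"
| "subst_symbol k a CoX = k - 1 - a"

definition subst_word :: "nat \<Rightarrow> nat \<Rightarrow> cg_symbol list \<Rightarrow> nat list" where
  "subst_word k a v = map (subst_symbol k a) v"

definition cg_line :: "nat \<Rightarrow> cg_symbol list \<Rightarrow> nat list list" where
  "cg_line k v = map (\<lambda>a. subst_word k a v) [0..<k]"

definition monochromatic :: "('a \<Rightarrow> nat) \<Rightarrow> 'a list \<Rightarrow> bool" where
  "monochromatic c L \<longleftrightarrow> (\<exists>j. \<forall>p \<in> set L. c p = j)"

definition has_CG_HJ_property :: "nat \<Rightarrow> nat \<Rightarrow> nat \<Rightarrow> bool" where
  "has_CG_HJ_property k r n \<longleftrightarrow>
     (\<forall>c \<in> cube k n \<rightarrow> {..<r}. \<exists>v \<in> cg_words k n. monochromatic c (cg_line k v))"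

text \<open>
  Such an \<open>n\<close> exists for all \<open>k, r \<ge> 1\<close> by the Hales-Jewett theorem, since every
  combinatorial line is a cg-line (given by a word without \<open>CoX\<close>); so the \<open>LEAST\<close> below
  is a genuine minimum.
\<close>

definition HJ_star :: "nat \<Rightarrow> nat \<Rightarrow> nat" where
  "HJ_star k r = (LEAST n. 0 < n \<and> has_CG_HJ_property k r n)"

end

theory Submission
  imports Defs
begin

text \<open>
  The lower bound comes from one explicit colouring. Give the letter \<open>a\<close> the weight
  \<open>0, 1, 2, 4, 8, \<dots>\<close> according to its distance \<open>min a (k - 1 - a)\<close> from the nearer end of the
  alphabet. This weight is invariant under \<open>a \<mapsto> k - 1 - a\<close>, so \<open>X\<close> and \<open>CoX\<close> contribute
  equally, and on a cg-line with \<open>j\<close> variable symbols the total weight of a point is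
  \<open>c + j * w\<close>, where \<open>w\<close> runs through \<open>0, 1, 2, 4, \<dots>, 2 ^ t\<close> with \<open>t = (k - 1) div 2 - 1\<close>.
  Cut the numbers into intervals of length \<open>H = 2 ^ t\<close>, coloured alternately. As long as
  \<open>c + j * w\<close> stays in the interval of \<open>c\<close>, we have \<open>j * w < H\<close>, so doubling \<open>w\<close> moves the total
  by less than one interval length; hence the sequence cannot jump over the neighbouring interval,
  which has the other colour. Since it ends at \<open>c + j * H\<close>, it does leave the first interval. The
  initial step from \<open>c\<close> to \<open>c + j\<close> is harmless when \<open>j \<le> H\<close>, so no cg-line is monochromatic
  in dimension \<open>n \<le> H\<close> (\<open>not_has_CG_HJ_property\<close>). Hence \<open>HJ_star k 2\<close> exceeds \<open>2 ^ t\<close>, of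
  order \<open>2 powr (k / 2)\<close>, and this is larger than the claimed bound for \<open>k \<ge> 4\<close>; for \<open>k \<le> 3\<close>
  the bound is below \<open>1\<close>.

  For this, \<open>HJ_star k 2\<close> has to be a number with the Hales-Jewett property, so the
  Hales-Jewett theorem itself enters (\<open>Hales_Jewett\<close>). Its proof is Shelah's: induction on the
  alphabet size, in which a new letter is made indistinguishable from \<open>0\<close>
  by passing to suitable blocks, each found by the pigeonhole principle.
\<close>

section \<open>The Hales-Jewett theorem\<close>

text \<open>
  In the word of a combinatorial line, \<open>None\<close> stands for the variable.
\<close>

definition inst :: "nat option list \<Rightarrow> nat \<Rightarrow> nat list" where
  "inst w a = map (case_option a (\<lambda>b. b)) w"

definition variable_word :: "nat \<Rightarrow> nat option list \<Rightarrow> bool" where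
  "variable_word k w \<longleftrightarrow> None \<in> set w \<and> set w \<subseteq> insert None (Some ` {..<k})"

definition plug :: "nat option list list \<Rightarrow> nat list \<Rightarrow> nat list" where
  "plug ws p = concat (map2 inst ws p)"

text \<open>
  A line in the subspace spanned by the blocks \<open>ws\<close>, read as a line in the whole cube: where \<open>v\<close>
  has its variable, the variables of the block become those of the line.
\<close>

definition compose :: "nat option list list \<Rightarrow> nat option list \<Rightarrow> nat option list" where
  "compose ws v =
     concat (map2 (\<lambda>w s. case s of None \<Rightarrow> w | Some b \<Rightarrow> map Some (inst w b)) ws v)"

definition merge :: "nat \<Rightarrow> nat \<Rightarrow> nat" where
  "merge k a = (if a = k then 0 else a)"

definition exchanging :: "nat \<Rightarrow> (nat list \<Rightarrow> nat) set \<Rightarrow> nat option list list \<Rightarrow> bool" where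
  "exchanging k F ws \<longleftrightarrow> (\<forall>w\<in>set ws. variable_word (Suc k) w) \<and>
     (\<forall>c\<in>F. \<forall>p\<in>cube (Suc k) (length ws). c (plug ws p) = c (plug ws (map (merge k) p)))"

lemma finite_cube: "finite (cube k n)"
proof -
  have "cube k n = {p. set p \<subseteq> {..<k} \<and> length p = n}"
    by (auto simp: cube_def)
  then show ?thesis by (simp add: finite_lists_length_eq)
qed

lemma inst_in_cube: "variable_word k w \<Longrightarrow> a < k \<Longrightarrow> inst w a \<in> cube k (length w)"
  by (auto simp: inst_def cube_def variable_word_def split: option.splits)

lemma append_in_cube: "p \<in> cube k m \<Longrightarrow> q \<in> cube k n \<Longrightarrow> p @ q \<in> cube k (m + n)"
  by (auto simp: cube_def)

lemma plug_in_cube: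
  assumes "\<forall>w\<in>set ws. variable_word k w" "p \<in> cube k (length ws)"
  shows "plug ws p \<in> cube k (length (concat ws))"
  using assms
proof (induction ws arbitrary: p)
  case Nil
  then show ?case by (simp add: plug_def cube_def)
next
  case (Cons w ws)
  then obtain a u where p: "p = a # u" "a < k" "u \<in> cube k (length ws)"
    by (cases p) (auto simp: cube_def)
  have "plug (w # ws) p = inst w a @ plug ws u"
    by (simp add: plug_def p)
  then show ?case
    using append_in_cube[OF inst_in_cube[of k w a] Cons.IH[OF _ p(3)]] Cons.prems p by simp
qed

lemma length_compose:
  "length v = length ws \<Longrightarrow> length (compose ws v) = length (concat ws)"
  by (induction v ws rule: list_induct2)
    (auto simp: compose_def inst_def split: option.splits)

lemma inst_compose:
  "length v = length ws \<Longrightarrow> inst (compose ws v) a = plug ws (inst v a)"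
  by (induction v ws rule: list_induct2)
    (auto simp: compose_def inst_def plug_def split: option.splits)

lemma variable_word_compose:
  assumes "length v = length ws" "\<forall>w\<in>set ws. variable_word k w" "variable_word k v"
  shows "variable_word k (compose ws v)"
proof -
  have letters: "set (inst w b) \<subseteq> {..<k}" if "variable_word k w" "b < k" for w b
    using inst_in_cube[OF that] by (simp add: cube_def)
  have "set (compose ws v) \<subseteq> insert None (Some ` {..<k})"
    if "set v \<subseteq> insert None (Some ` {..<k})"
    using assms(1,2) that
  proof (induction v ws rule: list_induct2)
    case Nil
    then show ?case by (simp add: compose_def)
  next
    case (Cons s v w ws)
    have "set (compose ws v) \<subseteq> insert None (Some ` {..<k})"
      using Cons by simp
    moreover have "set (case s of None \<Rightarrow> w | Some b \<Rightarrow> map Some (inst w b))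
        \<subseteq> insert None (Some ` {..<k})"
    proof (cases s)
      case None
      then show ?thesis using Cons.prems by (simp add: variable_word_def)
    next
      case (Some b)
      then have "b < k" using Cons.prems by auto
      then show ?thesis using letters[of w b] Cons.prems Some by auto
    qed
    ultimately show ?case by (simp add: compose_def)
  qed
  moreover have "None \<in> set (compose ws v)" if "None \<in> set v"
    using assms(1,2) that
    by (induction v ws rule: list_induct2)
      (auto simp: compose_def variable_word_def)
  ultimately show ?thesis using assms(3) by (simp add: variable_word_def)
qed

text \<open>
  Among the words consisting of letters \<open>k\<close> followed by letters \<open>0\<close>, more than there are joint
  colour patterns on all continuations, two have the same pattern. Turning the positions in which
  they differ into variables gives a block in which \<open>k\<close> and \<open>0\<close> are exchangeable.
\<close>

lemma exchangeable_block:
  fixes F :: "(nat list \<Rightarrow> nat) set"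
  assumes F: "finite F" "card F \<le> q" and r: "r > 0"
    and B: "B = r ^ (q * card (cube (Suc k) N))"
    and col: "F \<subseteq> cube (Suc k) (B + N) \<rightarrow> {..<r}"
  obtains w where "length w = B" "variable_word (Suc k) w"
    "\<forall>c\<in>F. \<forall>u\<in>cube (Suc k) N. c (inst w k @ u) = c (inst w 0 @ u)"
proof -
  define word where "word i = replicate i k @ replicate (B - i) 0" for i
  define D where "D = F \<times> cube (Suc k) N"
  define g where "g i = restrict (\<lambda>(c, u). c (word i @ u)) D" for i
  have finD: "finite D" using F finite_cube by (simp add: D_def)
  have "card D \<le> q * card (cube (Suc k) N)"
    using F(2) by (simp add: D_def card_cartesian_product)
  then have "card (D \<rightarrow>\<^sub>E {..<r}) \<le> B"
    using r finD by (simp add: card_PiE B power_increasing)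
  moreover have "g ` {..B} \<subseteq> D \<rightarrow>\<^sub>E {..<r}"
  proof -
    have "word i \<in> cube (Suc k) B" if "i \<le> B" for i
      using that by (auto simp: word_def cube_def)
    then show ?thesis
      using col append_in_cube by (fastforce simp: g_def D_def)
  qed
  ultimately have "card (g ` {..B}) \<le> B"
    using card_mono[of "D \<rightarrow>\<^sub>E {..<r}"] finD by (meson finite_PiE finite_lessThan order.trans)
  then have "\<not> inj_on g {..B}"
    by (intro pigeonhole) simp
  then obtain i j where ij: "i < j" "j \<le> B" "g i = g j"
    by (metis (no_types, lifting) atMost_iff inj_onI linorder_neqE_nat)
  define w where "w = replicate i (Some k) @ replicate (j - i) None @ replicate (B - j) (Some 0)"
  show thesis
  proof
    show "length w = B" "variable_word (Suc k) w"
      using ij by (auto simp: w_def variable_word_def)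
    have "replicate j k = replicate i k @ replicate (j - i) k"
      "replicate (B - i) (0::nat) = replicate (j - i) 0 @ replicate (B - j) 0"
      using ij(1,2) by (simp_all flip: replicate_add)
    then have inst: "inst w k = word j" "inst w 0 = word i"
      by (simp_all add: w_def word_def inst_def)
    show "\<forall>c\<in>F. \<forall>u\<in>cube (Suc k) N. c (inst w k @ u) = c (inst w 0 @ u)"
    proof (intro ballI)
      fix c u assume "c \<in> F" "u \<in> cube (Suc k) N"
      then have "(c, u) \<in> D" by (simp add: D_def)
      then have "c (word i @ u) = c (word j @ u)"
        using fun_cong[OF ij(3), of "(c, u)"] by (simp add: g_def)
      then show "c (inst w k @ u) = c (inst w 0 @ u)" by (simp add: inst)
    qed
  qed
qed

text \<open>
  The statement is about a family of colourings, with a bound on its size only: fixing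
  the entry of the first block turns each colouring into \<open>k + 1\<close> colourings of the remaining
  blocks, which all have to be treated at once.
\<close>

lemma exchangeable_blocks:
  assumes "r > 0"
  shows "\<exists>N. \<forall>F. finite F \<and> card F \<le> q \<and> F \<subseteq> cube (Suc k) N \<rightarrow> {..<r} \<longrightarrow>
    (\<exists>ws. length ws = n \<and> length (concat ws) = N \<and> exchanging k F ws)"
proof (induction n arbitrary: q)
  case 0
  show ?case
    by (rule exI[of _ 0]) (auto simp: cube_def exchanging_def)
next
  case (Suc n)
  obtain N where N: "\<And>F. finite F \<Longrightarrow> card F \<le> q * Suc k \<Longrightarrow> F \<subseteq> cube (Suc k) N \<rightarrow> {..<r} \<Longrightarrow>
      \<exists>ws. length ws = n \<and> length (concat ws) = N \<and> exchanging k F ws"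
    using Suc.IH[of "q * Suc k"] by meson
  define B where "B = r ^ (q * card (cube (Suc k) N))"
  show ?case
  proof (intro exI[of _ "B + N"] allI impI)
    fix F :: "(nat list \<Rightarrow> nat) set"
    assume "finite F \<and> card F \<le> q \<and> F \<subseteq> cube (Suc k) (B + N) \<rightarrow> {..<r}"
    then have F: "finite F" "card F \<le> q" "F \<subseteq> cube (Suc k) (B + N) \<rightarrow> {..<r}"
      by auto
    obtain w where w: "length w = B" "variable_word (Suc k) w"
      "\<forall>c\<in>F. \<forall>u\<in>cube (Suc k) N. c (inst w k @ u) = c (inst w 0 @ u)"
      using exchangeable_block[OF F(1,2) assms B_def F(3)] .
    define F' where "F' = (\<lambda>(c, a) u. c (inst w a @ u)) ` (F \<times> {..<Suc k})"
    have "card F' \<le> card (F \<times> {..<Suc k})"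
      unfolding F'_def using F(1) by (intro card_image_le) auto
    also have "\<dots> \<le> q * Suc k"
      using F(2) by (simp only: card_cartesian_product card_lessThan mult_le_mono1)
    finally have cF': "card F' \<le> q * Suc k" .
    have fF': "finite F'" using F(1) by (simp add: F'_def)
    have "F' \<subseteq> cube (Suc k) N \<rightarrow> {..<r}"
    proof -
      have "c (inst w a @ u) < r" if "c \<in> F" "a < Suc k" "u \<in> cube (Suc k) N" for c a u
        using F(3) that w(1) append_in_cube[OF inst_in_cube[OF w(2) that(2)] that(3)] by auto
      then show ?thesis by (auto simp: F'_def)
    qed
    then obtain ws where ws: "length ws = n" "length (concat ws) = N" "exchanging k F' ws"
      using N[OF fF' cF'] by blast
    have vws: "\<forall>w\<in>set ws. variable_word (Suc k) w"
      using ws(3) by (simp add: exchanging_def)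
    have "c (plug (w # ws) p) = c (plug (w # ws) (map (merge k) p))"
      if c: "c \<in> F" and p: "p \<in> cube (Suc k) (Suc n)" for c p
    proof -
      obtain a u where au: "p = a # u" "a < Suc k" "u \<in> cube (Suc k) n"
        using p by (cases p) (auto simp: cube_def)
      have "(\<lambda>u. c (inst w a @ u)) \<in> F'"
        using c au by (force simp: F'_def)
      then have "c (inst w a @ plug ws u) = c (inst w a @ plug ws (map (merge k) u))"
        using ws(1,3) au(3) unfolding exchanging_def by fastforce
      also have "\<dots> = c (inst w (merge k a) @ plug ws (map (merge k) u))"
      proof -
        have "map (merge k) u \<in> cube (Suc k) (length ws)"
          using au(3) ws(1) by (auto simp: cube_def merge_def)
        then have "plug ws (map (merge k) u) \<in> cube (Suc k) N"
          using plug_in_cube[OF vws] ws(2) by simp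
        then show ?thesis using w(3) c by (simp add: merge_def)
      qed
      finally show ?thesis by (simp add: au plug_def)
    qed
    then have "exchanging k F (w # ws)"
      using vws w(2) ws(1) by (simp add: exchanging_def)
    then show "\<exists>ws. length ws = Suc n \<and> length (concat ws) = B + N \<and> exchanging k F ws"
      using ws(1,2) w(1) by (intro exI[of _ "w # ws"]) auto
  qed
qed

text \<open>
  In the step, the blocks make the new letter \<open>k\<close> equivalent to the old letter \<open>0\<close>, so a
  line that is monochromatic over the old alphabet stays so at its last point.
\<close>

theorem Hales_Jewett:
  assumes "r > 0"
  shows "\<exists>n. \<forall>c \<in> cube k n \<rightarrow> {..<r}.
    (\<exists>w j. length w = n \<and> variable_word k w \<and> (\<forall>a<k. c (inst w a) = (j::nat)))"
proof (induction k)
  case 0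
  show ?case
    by (rule exI[of _ 1]) (auto intro!: exI[of _ "[None]"] simp: variable_word_def)
next
  case (Suc k)
  show ?case
  proof (cases "k = 0")
    \<comment> \<open>Without an old letter \<open>0\<close> there is nothing to merge \<open>k\<close> with, but lines have only one point.\<close>
    case True
    then show ?thesis
      by (intro exI[of _ 1]) (auto intro!: exI[of _ "[None]"] simp: variable_word_def)
  next
    case False
    obtain n where n: "\<And>c. c \<in> cube k n \<rightarrow> {..<r} \<Longrightarrow>
        \<exists>w j. length w = n \<and> variable_word k w \<and> (\<forall>a<k. c (inst w a) = j)"
      using Suc.IH by blast
    obtain N where N: "\<And>F. finite F \<Longrightarrow> card F \<le> 1 \<Longrightarrow> F \<subseteq> cube (Suc k) N \<rightarrow> {..<r} \<Longrightarrow>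
        \<exists>ws. length ws = n \<and> length (concat ws) = N \<and> exchanging k F ws"
      using exchangeable_blocks[OF assms, of 1 k n] by meson
    show ?thesis
    proof (intro exI[of _ N] ballI)
      fix c :: "nat list \<Rightarrow> nat" assume c: "c \<in> cube (Suc k) N \<rightarrow> {..<r}"
      obtain ws where len: "length ws = n" "length (concat ws) = N" and "exchanging k {c} ws"
        using N[of "{c}"] c by auto
      then have ws: "\<forall>w\<in>set ws. variable_word (Suc k) w"
        "\<And>p. p \<in> cube (Suc k) n \<Longrightarrow> c (plug ws p) = c (plug ws (map (merge k) p))"
        by (auto simp: exchanging_def)
      have sub: "cube k n \<subseteq> cube (Suc k) n" by (force simp: cube_def)
      have "plug ws p \<in> cube (Suc k) N" if "p \<in> cube k n" for p
        using plug_in_cube[OF ws(1), of p] len sub that by auto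
      then have "(\<lambda>p. c (plug ws p)) \<in> cube k n \<rightarrow> {..<r}"
        using c by auto
      then obtain v j where v: "length v = n" "variable_word k v"
        "\<And>a. a < k \<Longrightarrow> c (plug ws (inst v a)) = j"
        using n[of "\<lambda>p. c (plug ws p)"] by auto
      have v': "variable_word (Suc k) v" using v(2) by (force simp: variable_word_def)
      have "map (merge k) (inst v k) = inst v 0"
        using v(2) by (auto simp: inst_def merge_def variable_word_def split: option.splits)
      moreover have "inst v k \<in> cube (Suc k) n"
        using inst_in_cube[OF v', of k] v(1) by simp
      ultimately have "c (plug ws (inst v k)) = j"
        using ws(2) v(3)[of 0] False by simp
      then have "\<forall>a<Suc k. c (inst (compose ws v) a) = j"
        using v(1,3) len(1) by (simp add: inst_compose less_Suc_eq)
      then show "\<exists>w j. length w = N \<and> variable_word (Suc k) w \<and>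
          (\<forall>a<Suc k. c (inst w a) = j)"
        using variable_word_compose[OF _ ws(1) v'] length_compose[of v ws] v(1) len
        by (metis (no_types, lifting))
    qed
  qed
qed

lemma ex_has_CG_HJ_property:
  assumes "r > 0"
  shows "\<exists>n>0. has_CG_HJ_property k r n"
proof -
  obtain n where n: "\<And>c. c \<in> cube k n \<rightarrow> {..<r} \<Longrightarrow>
      \<exists>w j. length w = n \<and> variable_word k w \<and> (\<forall>a<k. c (inst w a) = j)"
    using Hales_Jewett[OF assms, of k] by blast
  have "n > 0"
    using n[of "\<lambda>_. 0"] assms by (auto simp: variable_word_def)
  moreover have "has_CG_HJ_property k r n"
    unfolding has_CG_HJ_property_def
  proof
    fix c assume "c \<in> cube k n \<rightarrow> {..<r}"
    then obtain w j where w: "length w = n" "variable_word k w" "\<forall>a<k. c (inst w a) = j"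
      using n[of c] by auto
    define v where "v = map (case_option X Letter) w"
    have "subst_word k a v = inst w a" for a
      by (auto simp: subst_word_def v_def inst_def split: option.splits)
    then have "monochromatic c (cg_line k v)"
      using w(3) by (auto simp: monochromatic_def cg_line_def)
    moreover have "v \<in> cg_words k n"
      using w(1,2) by (force simp: v_def cg_words_def variable_word_def split: option.splits)
    ultimately show "\<exists>v\<in>cg_words k n. monochromatic c (cg_line k v)" by blast
  qed
  ultimately show ?thesis by blast
qed

section \<open>A colouring without monochromatic cg-lines\<close>

text \<open>
  Rounding down turns the halves \<open>1 / 2, 1, 2, 4, \<dots>\<close> of the powers of two
  into the weights \<open>0, 1, 2, 4, \<dots>\<close>.
\<close>

definition weight :: "nat \<Rightarrow> nat \<Rightarrow> nat" where
  "weight k a = 2 ^ min a (k - 1 - a) div 2"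

fun is_Letter :: "cg_symbol \<Rightarrow> bool" where
  "is_Letter (Letter b) = True"
| "is_Letter _ = False"

text \<open>
  Let \<open>H = 2 ^ t\<close>. If the quotient by \<open>H\<close> has not changed up to \<open>c + j * 2 ^ i\<close>, then
  \<open>j * 2 ^ i < H\<close>, and this is also the length of the next step; so the next quotient is
  larger by at most one and, having the same parity, is the same again. But at
  \<open>c + j * H\<close> the quotient has changed.
\<close>

lemma quotient_parity_changes:
  fixes c j t :: nat
  assumes j: "0 < j" "j \<le> 2 ^ t"
  shows "\<exists>d \<le> Suc t. (c + j * (2 ^ d div 2)) div 2 ^ t mod 2 \<noteq> c div 2 ^ t mod 2"
proof (rule ccontr)
  let ?H = "2 ^ t :: nat"
  assume "\<not> ?thesis"
  then have par: "(c + j * (2 ^ d div 2)) div ?H mod 2 = c div ?H mod 2" if "d \<le> Suc t" for d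
    using that by blast
  have step: "(x + s) div ?H = x div ?H"
    if "s \<le> ?H" "(x + s) div ?H mod 2 = x div ?H mod 2" for x s :: nat
  proof -
    have "(x + s) div ?H \<le> (x + ?H) div ?H" using that(1) by (intro div_le_mono) simp
    then have "(x + s) div ?H \<le> Suc (x div ?H)" by simp
    moreover have "x div ?H \<le> (x + s) div ?H" by (intro div_le_mono) simp
    ultimately have "(x + s) div ?H = x div ?H \<or> (x + s) div ?H = Suc (x div ?H)" by linarith
    then show ?thesis using that(2) by (auto simp: mod_Suc split: if_splits)
  qed
  have same: "(c + j * 2 ^ i) div ?H = c div ?H" if "i \<le> t" for i
    using that
  proof (induction i)
    case 0
    then show ?case using step[of j c] par[of 1] j by simp
  next
    case (Suc i)
    have eq: "(c + j * 2 ^ i) div ?H = c div ?H" using Suc by simp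
    have "j * 2 ^ i < ?H"
    proof (rule ccontr)
      assume "\<not> j * 2 ^ i < ?H"
      then have "(c + ?H) div ?H \<le> (c + j * 2 ^ i) div ?H" by (intro div_le_mono) simp
      then show False using eq by simp
    qed
    moreover have dbl: "c + j * 2 ^ Suc i = (c + j * 2 ^ i) + j * 2 ^ i" by simp
    moreover have "(c + j * 2 ^ Suc i) div ?H mod 2 = c div ?H mod 2"
      using par[of "Suc (Suc i)"] Suc.prems by simp
    ultimately show ?case
      using step[of "j * 2 ^ i" "c + j * 2 ^ i"] eq unfolding dbl by simp
  qed
  have "(c + ?H) div ?H \<le> (c + j * ?H) div ?H" using j by (intro div_le_mono) simp
  then show False using same[of t] by simp
qed

lemma sum_weight_subst_word:
  assumes "a < k"
  shows "sum_list (map (weight k) (subst_word k a v)) =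
    sum_list (map (weight k) (subst_word k 0 (filter is_Letter v))) +
    length (filter (\<lambda>s. \<not> is_Letter s) v) * weight k a"
proof (induction v)
  case Nil
  then show ?case by (simp add: subst_word_def)
next
  case (Cons s v)
  have "weight k (k - 1 - a) = weight k a"
    using assms by (simp add: weight_def min.commute)
  then show ?case
    using Cons by (cases s) (auto simp: subst_word_def)
qed

lemma not_has_CG_HJ_property:
  assumes k: "k \<ge> 3" and n: "n \<le> 2 ^ ((k - 1) div 2 - 1)"
  shows "\<not> has_CG_HJ_property k 2 n"
proof
  define t where "t = (k - 1) div 2 - 1"
  define c where "c p = sum_list (map (weight k) p) div 2 ^ t mod 2" for p
  assume "has_CG_HJ_property k 2 n"
  moreover have "c \<in> cube k n \<rightarrow> {..<2}" by (simp add: c_def)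
  ultimately obtain v i where v: "v \<in> cg_words k n"
    and mono: "\<And>a. a < k \<Longrightarrow> c (subst_word k a v) = i"
    by (force simp: has_CG_HJ_property_def monochromatic_def cg_line_def)
  define b where "b = sum_list (map (weight k) (subst_word k 0 (filter is_Letter v)))"
  define j where "j = length (filter (\<lambda>s. \<not> is_Letter s) v)"
  have "X \<in> set (filter (\<lambda>s. \<not> is_Letter s) v)"
    using v by (simp add: cg_words_def)
  then have "0 < j" unfolding j_def by (rule length_pos_if_in_set)
  moreover have "j \<le> 2 ^ t"
    using v n length_filter_le[of _ v] le_trans unfolding j_def t_def cg_words_def by blast
  ultimately obtain d where d: "d \<le> Suc t"
    "(b + j * (2 ^ d div 2)) div 2 ^ t mod 2 \<noteq> b div 2 ^ t mod 2"
    using quotient_parity_changes by blast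
  have dk: "d \<le> (k - 1) div 2" using d(1) k by (simp add: t_def)
  then have "d < k" "weight k d = 2 ^ d div 2" "weight k 0 = 0"
    using k by (auto simp: weight_def min_def)
  then have "c (subst_word k d v) \<noteq> c (subst_word k 0 v)"
    using d(2) k unfolding c_def
    by (simp add: sum_weight_subst_word[of _ k v] flip: b_def j_def)
  then show False using mono \<open>d < k\<close> k by simp
qed

section \<open>The lower bound\<close>

lemma HJ_star_positive: "r > 0 \<Longrightarrow> HJ_star k r > 0"
  and HJ_star_property: "r > 0 \<Longrightarrow> has_CG_HJ_property k r (HJ_star k r)"
  using LeastI_ex[OF ex_has_CG_HJ_property[of r k]] by (auto simp: HJ_star_def)

theorem theorem23:
  fixes k :: nat
  assumes "k \<ge> 2"
  shows "real (HJ_star k 2) >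
    (2 powr ((real k - 1) / 3) - 1) / (real k - 1) powr (2 / 3)"
proof (cases "k \<le> 3")
  case True
  have "2 powr ((real k - 1) / 3) < (2::real) powr 1"
    using True by (intro powr_less_mono) auto
  then have "2 powr ((real k - 1) / 3) - 1 < (1::real)" by simp
  also have "1 \<le> (real k - 1) powr (2 / 3)"
    using assms by (intro ge_one_powr_ge_zero) auto
  finally have "(2 powr ((real k - 1) / 3) - 1) / (real k - 1) powr (2 / 3) < 1"
    using assms by simp
  also have "1 \<le> real (HJ_star k 2)"
    using HJ_star_positive[of 2 k] by simp
  finally show ?thesis .
next
  case False
  then have k: "k \<ge> 4" by simp
  define D where "D = (real k - 1) powr (2 / 3)"
  have "\<not> HJ_star k 2 \<le> 2 ^ ((k - 1) div 2 - 1)"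
    using not_has_CG_HJ_property[of k "HJ_star k 2"] HJ_star_property[of 2 k] k by auto
  then have "real (2 ^ ((k - 1) div 2 - 1)) < real (HJ_star k 2)"
    by linarith
  moreover have "2 powr (real k / 2 - 2) \<le> real (2 ^ ((k - 1) div 2 - 1))"
  proof -
    have "k \<le> 2 * ((k - 1) div 2 - 1) + 4" using k by presburger
    then have "real k \<le> 2 * real ((k - 1) div 2 - 1) + 4" by linarith
    then have "2 powr (real k / 2 - 2) \<le> (2::real) powr real ((k - 1) div 2 - 1)"
      by (intro powr_mono) auto
    then show ?thesis by (simp add: powr_realpow)
  qed
  moreover have "(2 powr ((real k - 1) / 3) - 1) / D < 2 powr (real k / 2 - 2)"
  proof -
    \<comment> \<open>After dividing by \<open>2 powr (k / 2 - 2)\<close>, the exponent \<open>5 / 3 - k / 6\<close> is at most \<open>1\<close>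
      from \<open>k = 4\<close> on, where \<open>D\<close> is already the cube root of \<open>9 > 2 ^ 3\<close>.\<close>
    have "2 powr ((real k - 1) / 3) = 2 powr (real k / 2 - 2) * (2::real) powr (5 / 3 - real k / 6)"
    proof -
      have "(real k - 1) / 3 = (real k / 2 - 2) + (5 / 3 - real k / 6)" by (simp add: field_simps)
      then show ?thesis by (simp only: powr_add)
    qed
    also have "\<dots> \<le> 2 powr (real k / 2 - 2) * D"
    proof (intro mult_left_mono)
      have "(2::real) powr (5 / 3 - real k / 6) \<le> 2 powr 1"
        using k by (intro powr_mono) auto
      also have "\<dots> = (2 powr 3) powr (1 / 3)" by (subst powr_powr) simp
      also have "\<dots> \<le> (3 powr 2) powr (1 / 3)" by (intro powr_mono2) auto
      also have "\<dots> = 3 powr (2 / 3)" by (subst powr_powr) simp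
      also have "\<dots> \<le> D" unfolding D_def using k by (intro powr_mono2) auto
      finally show "2 powr (5 / 3 - real k / 6) \<le> D" .
    qed simp
    finally have "2 powr ((real k - 1) / 3) - 1 < 2 powr (real k / 2 - 2) * D" by simp
    moreover have "D > 0" using k by (simp add: D_def)
    ultimately show ?thesis by (simp add: divide_less_eq)
  qed
  ultimately show ?thesis unfolding D_def by linarith
qed

end
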